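(* The problem CNFSat over definable structures is undecidable: there is no algorithm which, given (a finite presentation of) a definable CNF formula $\varphi$, decides whether $\varphi$ is satisfiable.
   Context: Fix a countably infinite set $\mathbb{A}$ of atoms and an infinite set of atom variables. An expression is either a variable or a formal finite (possibly empty) union of set-builder expressions $\{e \mid x_1,\dots,x_k\in\mathbb{A},\ \varphi\}$ (with $k\ge 0$), where $e$ is an expression, the $x_i$ are bound variables, and $\varphi$ is a first-order formula over the atom variables with equality as the only relation symbol (interpreted in $(\mathbb{A},=)$). An expression $e$ with set of free variables $V$, together with a valuation $\sigma:V\to\mathbb{A}$, has a value $e[\sigma]$, defined in the obvious way by induction on $e$, which is an atom or a set; the sets arising this way are called definable. Pairs, tuples, integers, constants, disjoint unions etc. are encoded by standard set-theoretic means (e.g. $(x,y)=\{x,\{x,y\}\}$). A definable set is presented to an algorithm as a pair $(e,\sigma)$. A CNF propositional formula over a (definable) set $X$ of propositional variables is a family of subsets of $X\times\{0,1\}$, each subset representing a (possibly infinite) disjunctive clause, where $(x,1)$ stands for the literal $x$ and $(x,0)$ for $\neg x$. The formula is definable if this family is a definable set. It is satisfiable if there is an (arbitrary, not necessarily definable) valuation $X\to\{0,1\}$ making at least one literal true in every clause. *)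

theory Defs
  imports Main "HOL-Library.Countable_Set_Type" "HOL-Library.Nat_Bijection"
begin

section \<open>Sets with atoms\<close>

text \<open>
  The universe of hereditarily countable sets over a type \<^typ>\<open>'a\<close> of atoms. If there are only
  countably many atoms, all sets occurring in the value of an expression are countable, so this
  universe is large enough. The sets are extensional, well-founded, and distinct from the atoms.
\<close>

datatype 'a hset = Atom 'a | HSet "'a hset cset"

definition mk_set :: "'a hset set \<Rightarrow> 'a hset" where
  "mk_set S = HSet (acset S)"

fun elems :: "'a hset \<Rightarrow> 'a hset set" where
  "elems (Atom a) = {}"
| "elems (HSet A) = rcset A"

definition is_set :: "'a hset \<Rightarrow> bool" where
  "is_set s \<longleftrightarrow> (\<exists>A. s = HSet A)"

lemma elems_mk_set: "countable S \<Longrightarrow> elems (mk_set S) = S"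
  by (simp add: mk_set_def)

lemma hset_eqI: "is_set s \<Longrightarrow> is_set t \<Longrightarrow> elems s = elems t \<Longrightarrow> s = t"
  by (auto simp: is_set_def rcset_inject)

text \<open>The pair \<open>(x, y) = {x, {x, y}}\<close>.\<close>

definition pair :: "'a hset \<Rightarrow> 'a hset \<Rightarrow> 'a hset" where
  "pair x y = mk_set {x, mk_set {x, y}}"

lemma hset_no_2_cycle: "x \<in> elems y \<Longrightarrow> y \<notin> elems x"
proof (induction y arbitrary: x)
  case (HSet A)
  show ?case
  proof
    assume "HSet A \<in> elems x"
    moreover have "x \<in> rcset A" using HSet.prems by simp
    ultimately show False using HSet.IH[of x "HSet A"] by simp
  qed
qed simp

lemma pair_inject: "pair x y = pair x' y' \<longleftrightarrow> x = x' \<and> y = y'"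
proof
  assume eq: "pair x y = pair x' y'"
  have *: "{x, mk_set {x, y}} = {x', mk_set {x', y'}}"
    using arg_cong[OF eq, of elems] by (simp add: pair_def elems_mk_set)
  have "x = x'"
  proof (rule ccontr)
    assume "x \<noteq> x'"
    with * have "x = mk_set {x', y'}" "x' = mk_set {x, y}" by auto
    then have "x' \<in> elems x" "x \<in> elems x'" by (metis elems_mk_set countable_insert countable_empty insertI1)+
    then show False using hset_no_2_cycle by blast
  qed
  with * have "mk_set {x, y} = mk_set {x, y'}"
    by (metis doubleton_eq_iff)
  then have "{x, y} = {x, y'}"
    by (metis elems_mk_set countable_insert countable_empty)
  then have "y = y'" by (metis doubleton_eq_iff)
  with \<open>x = x'\<close> show "x = x' \<and> y = y'" ..
qed simp

text \<open>The integers \<open>0 = {}\<close> and \<open>1 = {0}\<close>, with \<^const>\<open>True\<close> standing for \<open>1\<close>.\<close>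

definition bit01 :: "bool \<Rightarrow> 'a hset" where
  "bit01 b = (if b then mk_set {mk_set {}} else mk_set {})"


section \<open>Expressions and definable sets\<close>

text \<open>First-order formulas over equality; the atom variables are the natural numbers.\<close>

datatype form =
    Eq nat nat
  | Neg form
  | Conj form form
  | Disj form form
  | Ex nat form
  | All nat form

fun sat :: "(nat \<Rightarrow> 'a) \<Rightarrow> form \<Rightarrow> bool" where
  "sat \<sigma> (Eq x y) \<longleftrightarrow> \<sigma> x = \<sigma> y"
| "sat \<sigma> (Neg \<phi>) \<longleftrightarrow> \<not> sat \<sigma> \<phi>"
| "sat \<sigma> (Conj \<phi> \<psi>) \<longleftrightarrow> sat \<sigma> \<phi> \<and> sat \<sigma> \<psi>"
| "sat \<sigma> (Disj \<phi> \<psi>) \<longleftrightarrow> sat \<sigma> \<phi> \<or> sat \<sigma> \<psi>"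
| "sat \<sigma> (Ex x \<phi>) \<longleftrightarrow> (\<exists>a. sat (\<sigma>(x := a)) \<phi>)"
| "sat \<sigma> (All x \<phi>) \<longleftrightarrow> (\<forall>a. sat (\<sigma>(x := a)) \<phi>)"

fun form_fv :: "form \<Rightarrow> nat set" where
  "form_fv (Eq x y) = {x, y}"
| "form_fv (Neg \<phi>) = form_fv \<phi>"
| "form_fv (Conj \<phi> \<psi>) = form_fv \<phi> \<union> form_fv \<psi>"
| "form_fv (Disj \<phi> \<psi>) = form_fv \<phi> \<union> form_fv \<psi>"
| "form_fv (Ex x \<phi>) = form_fv \<phi> - {x}"
| "form_fv (All x \<phi>) = form_fv \<phi> - {x}"

text \<open>
  \<open>Builder e [x1, \<dots>, xk] \<phi>\<close> is the set-builder expression \<open>{e | x1, \<dots>, xk \<in> A, \<phi>}\<close>, and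
  \<open>Builders\<close> is the formal union of a list of these.
\<close>

datatype expr = Var nat | Builders "builder list"
     and builder = Builder expr "nat list" form

fun expr_fv :: "expr \<Rightarrow> nat set" and builder_fv :: "builder \<Rightarrow> nat set" where
  "expr_fv (Var x) = {x}"
| "expr_fv (Builders bs) = (\<Union>b\<in>set bs. builder_fv b)"
| "builder_fv (Builder e xs \<phi>) = (expr_fv e \<union> form_fv \<phi>) - set xs"

text \<open>
  Evaluation uses total valuations; only their restriction to the free variables matters.
\<close>

fun expr_val :: "expr \<Rightarrow> (nat \<Rightarrow> 'a) \<Rightarrow> 'a hset"
and builder_vals :: "builder \<Rightarrow> (nat \<Rightarrow> 'a) \<Rightarrow> 'a hset set" where
  "expr_val (Var x) \<sigma> = Atom (\<sigma> x)"
| "expr_val (Builders bs) \<sigma> = mk_set (\<Union>b\<in>set bs. builder_vals b \<sigma>)"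
| "builder_vals (Builder e xs \<phi>) \<sigma> =
     {expr_val e \<tau> | \<tau>. (\<forall>y. y \<notin> set xs \<longrightarrow> \<tau> y = \<sigma> y) \<and> sat \<tau> \<phi>}"

lemma countable_builder_vals:
  assumes "countable (UNIV :: 'a set)"
  shows "countable (builder_vals b (\<sigma> :: nat \<Rightarrow> 'a))"
proof (cases b)
  case (Builder e xs \<phi>)
  let ?upd = "\<lambda>as y. case map_of (zip xs as) y of None \<Rightarrow> \<sigma> y | Some a \<Rightarrow> a"
  have "\<tau> = ?upd (map \<tau> xs)" if "\<forall>y. y \<notin> set xs \<longrightarrow> \<tau> y = \<sigma> y" for \<tau> :: "nat \<Rightarrow> 'a"
  proof
    fix y show "\<tau> y = ?upd (map \<tau> xs) y"
      using that by (auto simp: map_of_zip_map)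
  qed
  then have "builder_vals b \<sigma> \<subseteq> (\<lambda>as. expr_val e (?upd as)) ` lists UNIV"
  proof -
    assume *: "\<And>\<tau>. \<forall>y. y \<notin> set xs \<longrightarrow> \<tau> y = \<sigma> y \<Longrightarrow> \<tau> = ?upd (map \<tau> xs)"
    show ?thesis
    proof
      fix s assume "s \<in> builder_vals b \<sigma>"
      then obtain \<tau> where "s = expr_val e \<tau>" "\<forall>y. y \<notin> set xs \<longrightarrow> \<tau> y = \<sigma> y"
        unfolding Builder by auto
      then have "s = expr_val e (?upd (map \<tau> xs))" using * by metis
      then show "s \<in> (\<lambda>as. expr_val e (?upd as)) ` lists UNIV" by blast
    qed
  qed
  then show ?thesis
    by (rule countable_subset) (intro countable_image countable_lists assms)
qed

lemma elems_expr_val: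
  assumes "countable (UNIV :: 'a set)"
  shows "elems (expr_val (Builders bs) (\<sigma> :: nat \<Rightarrow> 'a)) = (\<Union>b\<in>set bs. builder_vals b \<sigma>)"
  by (simp add: elems_mk_set countable_builder_vals[OF assms] countable_finite)

text \<open>
  A presentation \<open>(e, \<sigma>)\<close>, where \<open>\<sigma>\<close> is the finite graph of a valuation of the free variables
  of \<open>e\<close>, listed in some order.
\<close>

type_synonym 'a presentation = "expr \<times> (nat \<times> 'a) list"

definition presentation :: "'a presentation \<Rightarrow> bool" where
  "presentation P \<longleftrightarrow> (case P of (e, \<sigma>) \<Rightarrow>
     distinct (map fst \<sigma>) \<and> set (map fst \<sigma>) = expr_fv e)"

definition pres_val :: "'a presentation \<Rightarrow> 'a hset" where
  "pres_val P = (case P of (e, \<sigma>) \<Rightarrow> expr_val e (\<lambda>x. the (map_of \<sigma> x)))"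

definition definable_set :: "'a hset \<Rightarrow> bool" where
  "definable_set s \<longleftrightarrow> is_set s \<and> (\<exists>P. presentation P \<and> s = pres_val P)"


section \<open>CNF formulas\<close>

definition cnf_over :: "'a hset \<Rightarrow> 'a hset \<Rightarrow> bool" where
  "cnf_over X F \<longleftrightarrow> is_set X \<and> is_set F \<and>
     (\<forall>C\<in>elems F. is_set C \<and> elems C \<subseteq> {pair x (bit01 b) | x b. x \<in> elems X})"

text \<open>The values of \<open>v\<close> outside of \<open>X\<close> are irrelevant.\<close>

definition satisfiable :: "'a hset \<Rightarrow> 'a hset \<Rightarrow> bool" where
  "satisfiable X F \<longleftrightarrow> (\<exists>v :: 'a hset \<Rightarrow> bool.
     \<forall>C\<in>elems F. \<exists>x\<in>elems X. pair x (bit01 (v x)) \<in> elems C)"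

definition CNF_instances :: "'a presentation set" where
  "CNF_instances = {P. presentation P \<and>
     (\<exists>X. definable_set X \<and> cnf_over X (pres_val P))}"

definition CNFSat :: "'a presentation set" where
  "CNFSat = {P. presentation P \<and>
     (\<exists>X. definable_set X \<and> cnf_over X (pres_val P) \<and> satisfiable X (pres_val P))}"


section \<open>Decidability\<close>

text \<open>
  Partial recursive functions: \<open>Prec f g\<close> is primitive recursion on the first argument,
  \<open>Mu f\<close> is minimization over the first argument of \<open>f\<close>. The relation \<open>computes p xs y\<close> says
  that \<open>p\<close> terminates on the arguments \<open>xs\<close> with result \<open>y\<close>.
\<close>

datatype recf = Zero | Succ | Proj nat | Comp recf "recf list" | Prec recf recf | Mu recf

inductive computes :: "recf \<Rightarrow> nat list \<Rightarrow> nat \<Rightarrow> bool" where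
  computes_Zero: "computes Zero xs 0"
| computes_Succ: "computes Succ [x] (Suc x)"
| computes_Proj: "i < length xs \<Longrightarrow> computes (Proj i) xs (xs ! i)"
| computes_Comp: "list_all2 (\<lambda>g y. computes g xs y) gs ys \<Longrightarrow> computes f ys z \<Longrightarrow>
    computes (Comp f gs) xs z"
| computes_Prec_0: "computes f xs y \<Longrightarrow> computes (Prec f g) (0 # xs) y"
| computes_Prec_Suc: "computes (Prec f g) (n # xs) y \<Longrightarrow> computes g (n # y # xs) z \<Longrightarrow>
    computes (Prec f g) (Suc n # xs) z"
| computes_Mu: "computes f (n # xs) 0 \<Longrightarrow> (\<forall>m<n. \<exists>y. computes f (m # xs) (Suc y)) \<Longrightarrow>
    computes (Mu f) xs n"

lemma computes_deterministic:
  "computes p xs y \<Longrightarrow> computes p xs z \<Longrightarrow> y = z"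
proof (induction arbitrary: z rule: computes.induct)
  case (computes_Comp xs gs ys f y z)
  from computes_Comp.prems obtain ys' where
    ys': "list_all2 (\<lambda>g y. computes g xs y) gs ys'" "computes f ys' z"
    by (auto elim: computes.cases)
  have "ys = ys'"
    using computes_Comp.IH(1) ys'(1)
    by (auto simp: list_all2_conv_all_nth intro!: nth_equalityI)
  then show ?case
    using computes_Comp.IH(2) ys'(2) by blast
next
  case (computes_Prec_0 f xs y g)
  from computes_Prec_0.prems have "computes f xs z"
    by (auto elim: computes.cases)
  then show ?case by (rule computes_Prec_0.IH)
next
  case (computes_Prec_Suc f g n xs y y')
  from computes_Prec_Suc.prems obtain u where
    "computes (Prec f g) (n # xs) u" "computes g (n # u # xs) z"
    by (auto elim: computes.cases)
  then show ?case using computes_Prec_Suc.IH by blast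
next
  case (computes_Mu f n xs)
  from computes_Mu.prems have z: "computes f (z # xs) 0"
      "\<forall>m<z. \<exists>y. computes f (m # xs) (Suc y)"
    by (auto elim: computes.cases)
  show ?case
  proof (rule linorder_cases[of n z])
    assume "n < z"
    then show ?thesis using z(2) computes_Mu.IH(1) by blast
  next
    assume "z < n"
    then show ?thesis using computes_Mu.IH(2) z(1) by blast
  qed
qed (auto elim: computes.cases)

text \<open>
  \<open>I\<close> is the set of instances and \<open>Y\<close> the set of instances with answer \<open>yes\<close>. Nothing is required
  of the algorithm, not even termination, on inputs that do not encode an instance.
\<close>

definition decidable :: "('i \<Rightarrow> nat) \<Rightarrow> 'i set \<Rightarrow> 'i set \<Rightarrow> bool" where
  "decidable code I Y \<longleftrightarrow>
     (\<exists>p. \<forall>x\<in>I. computes p [code x] (if x \<in> Y then 1 else 0))"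

fun form_code :: "form \<Rightarrow> nat" where
  "form_code (Eq x y) = list_encode [0, x, y]"
| "form_code (Neg \<phi>) = list_encode [1, form_code \<phi>]"
| "form_code (Conj \<phi> \<psi>) = list_encode [2, form_code \<phi>, form_code \<psi>]"
| "form_code (Disj \<phi> \<psi>) = list_encode [3, form_code \<phi>, form_code \<psi>]"
| "form_code (Ex x \<phi>) = list_encode [4, x, form_code \<phi>]"
| "form_code (All x \<phi>) = list_encode [5, x, form_code \<phi>]"

fun expr_code :: "expr \<Rightarrow> nat" and builder_code :: "builder \<Rightarrow> nat" where
  "expr_code (Var x) = list_encode [0, x]"
| "expr_code (Builders bs) = list_encode (1 # map builder_code bs)"
| "builder_code (Builder e xs \<phi>) =
     list_encode [expr_code e, list_encode xs, form_code \<phi>]"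

lemma form_code_inject: "form_code \<phi> = form_code \<psi> \<longleftrightarrow> \<phi> = \<psi>"
proof (induction \<phi> arbitrary: \<psi>)
qed (case_tac \<psi>; simp add: list_encode_eq del: list_encode.simps)+

lemma
  shows expr_code_inject: "expr_code e = expr_code e' \<longleftrightarrow> e = e'"
    and builder_code_inject: "builder_code b = builder_code b' \<longleftrightarrow> b = b'"
proof (induction e and b arbitrary: e' and b' rule: expr_code_builder_code.induct)
  case (2 bs)
  have "map builder_code bs = map builder_code bs' \<longleftrightarrow> bs = bs'" for bs'
    using 2 by (auto simp: list_eq_iff_nth_eq)
  then show ?case
    by (cases e') (simp_all add: list_encode_eq del: list_encode.simps)
next
  case (1 x)
  show ?case by (cases e') (simp_all add: list_encode_eq del: list_encode.simps)
next
  case (3 e xs \<phi>)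
  then show ?case
    by (cases b') (simp add: list_encode_eq form_code_inject del: list_encode.simps)
qed

text \<open>Atoms are given to an algorithm by their index in a numbering \<open>num\<close> of the atoms.\<close>

definition pres_code :: "('a \<Rightarrow> nat) \<Rightarrow> 'a presentation \<Rightarrow> nat" where
  "pres_code num P = (case P of (e, \<sigma>) \<Rightarrow>
     prod_encode (expr_code e, list_encode (map (\<lambda>(x, a). prod_encode (x, num a)) \<sigma>)))"

lemma pres_code_inject:
  assumes "inj num"
  shows "pres_code num P = pres_code num Q \<longleftrightarrow> P = Q"
proof -
  have "inj (\<lambda>(x, a). prod_encode (x, num a))"
    using assms by (auto simp: inj_def)
  then show ?thesis
    by (auto simp: pres_code_def list_encode_eq expr_code_inject inj_map_eq_map split: prod.splits)
qed

end

(*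
  Suppose that p decides the problem. Infinite clauses express totality: for all a there is b with
  R(a, b). So a definable CNF can force numbers and lists of numbers to have interpretations
  as atoms, and the rules defining the graph of a fixed recursive function e become finitely many
  Horn clauses. In every model these clauses derive each true statement "e(n) = 1", while the
  recursive functions themselves form a model deriving nothing else. Adding a clause which denies
  e(n) = 1 therefore gives a formula that is satisfiable iff e(n) is not 1.

  No universal machine is needed, by diagonalization over the formulas: let r map the code h of any
  family T of Horn clauses to the code of T plus the clause denying the goal at the number h, and
  let e be p after r. If h codes the Horn clauses of e, then r(h) is satisfiable iff e(h) is not 1,
  that is, iff p says that it is not.
*)
theory Submission
  imports Defs
begin

section \<open>Total recursive functions\<close>

text \<open>Programs are hidden behind functions on argument lists, so that the closure lemmas work
  as introduction rules for terms in \<open>xs ! i\<close>. At lengths other than \<open>k\<close>,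
  \<open>F\<close> is unconstrained.\<close>

definition total_recursive :: "nat \<Rightarrow> (nat list \<Rightarrow> nat) \<Rightarrow> bool" where
  "total_recursive k F \<longleftrightarrow> (\<exists>p. \<forall>xs. length xs = k \<longrightarrow> computes p xs (F xs))"

lemma total_recursive_proj: "i < k \<Longrightarrow> total_recursive k (\<lambda>xs. xs ! i)"
  unfolding total_recursive_def by (auto intro: computes_Proj)

lemma total_recursive_comp:
  assumes "total_recursive (length Gs) F" "\<And>G. G \<in> set Gs \<Longrightarrow> total_recursive k G"
  shows "total_recursive k (\<lambda>xs. F (map (\<lambda>G. G xs) Gs))"
proof -
  obtain f where f: "\<And>xs. length xs = length Gs \<Longrightarrow> computes f xs (F xs)"
    using assms(1) unfolding total_recursive_def by blast
  obtain g where g: "\<And>G xs. G \<in> set Gs \<Longrightarrow> length xs = k \<Longrightarrow> computes (g G) xs (G xs)"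
    using assms(2) unfolding total_recursive_def by metis
  have "computes (Comp f (map g Gs)) xs (F (map (\<lambda>G. G xs) Gs))" if "length xs = k" for xs
    using g[OF _ that]
    by (intro computes_Comp[OF _ f]) (auto simp: list_all2_map1 list_all2_map2 intro!: list.rel_refl_strong)
  then show ?thesis unfolding total_recursive_def by blast
qed

lemma total_recursive_comp1:
  "total_recursive 1 (\<lambda>xs. f (xs ! 0)) \<Longrightarrow> total_recursive k G \<Longrightarrow> total_recursive k (\<lambda>xs. f (G xs))"
  using total_recursive_comp[of "[G]" "\<lambda>xs. f (xs ! 0)" k] by simp

lemma total_recursive_comp2:
  "total_recursive 2 (\<lambda>xs. f (xs ! 0) (xs ! 1)) \<Longrightarrow> total_recursive k G \<Longrightarrow> total_recursive k H \<Longrightarrow>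
    total_recursive k (\<lambda>xs. f (G xs) (H xs))"
  using total_recursive_comp[of "[G, H]" "\<lambda>xs. f (xs ! 0) (xs ! 1)" k]
  by (auto simp: numeral_2_eq_2)

lemma total_recursive_Suc: "total_recursive k F \<Longrightarrow> total_recursive k (\<lambda>xs. Suc (F xs))"
proof (erule total_recursive_comp1[rotated])
  show "total_recursive 1 (\<lambda>xs. Suc (xs ! 0))"
    unfolding total_recursive_def by (auto simp: length_Suc_conv intro!: exI[of _ Succ] computes_Succ)
qed

lemma total_recursive_const: "total_recursive k (\<lambda>xs. c)"
proof (induction c)
  case 0
  show ?case unfolding total_recursive_def by (blast intro: computes_Zero)
qed (rule total_recursive_Suc)

text \<open>Recursion without parameters: \<open>F 0\<close> is a single number, computed by a
  constant program of arity 0.\<close>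

lemma total_recursive_primrec:
  assumes step: "total_recursive 2 G" "\<And>n. F (Suc n) = G [n, F n]"
  shows "total_recursive 1 (\<lambda>xs. F (xs ! 0))"
proof -
  obtain g where g: "\<And>xs. length xs = 2 \<Longrightarrow> computes g xs (G xs)"
    using step(1) unfolding total_recursive_def by blast
  obtain c where c: "computes c [] (F 0)"
    using total_recursive_const[of 0 "F 0"] unfolding total_recursive_def by auto
  have "computes (Prec c g) [n] (F n)" for n
  proof (induction n)
    case (Suc n)
    show ?case using computes_Prec_Suc[OF Suc g[of "[n, F n]"]] step(2) by simp
  qed (rule computes_Prec_0[OF c])
  then show ?thesis
    unfolding total_recursive_def by (auto simp: length_Suc_conv intro!: exI[of _ "Prec c g"])
qed

lemma total_recursive_add:
  "total_recursive k F \<Longrightarrow> total_recursive k G \<Longrightarrow> total_recursive k (\<lambda>xs. F xs + G xs)"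
proof (erule (1) total_recursive_comp2[rotated])
  let ?add = "Prec (Proj 0) (Comp Succ [Proj 1])"
  have "computes ?add [m, n] (m + n)" for m n
  proof (induction m)
    case 0
    show ?case using computes_Proj[of 0 "[n]"] by (auto intro: computes_Prec_0)
  next
    case (Suc m)
    have "computes (Proj 1) [m, m + n, n] (m + n)"
      using computes_Proj[of 1 "[m, m + n, n]"] by simp
    then have "computes (Comp Succ [Proj 1]) [m, m + n, n] (Suc (m + n))"
      by (intro computes_Comp[OF _ computes_Succ]) simp
    then show ?case using computes_Prec_Suc[OF Suc] by simp
  qed
  then show "total_recursive 2 (\<lambda>xs. xs ! 0 + xs ! 1)"
    unfolding total_recursive_def
    by (auto simp: length_Suc_conv numeral_2_eq_2 intro!: exI[of _ ?add])
qed

text \<open>The Cantor pairing of m and n is \<open>triangle (m + n) + m\<close>, and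
  \<open>triangle\<close> is a primitive recursion on addition.\<close>

lemma total_recursive_prod_encode:
  assumes "total_recursive k F" "total_recursive k G"
  shows "total_recursive k (\<lambda>xs. prod_encode (F xs, G xs))"
proof -
  have "total_recursive 1 (\<lambda>xs. triangle (xs ! 0))"
  proof (rule total_recursive_primrec)
    show "total_recursive 2 (\<lambda>xs. xs ! 1 + Suc (xs ! 0))"
      by (intro total_recursive_add total_recursive_Suc total_recursive_proj) simp_all
  qed simp
  from total_recursive_comp1[OF this] show ?thesis
    unfolding prod_encode_def by (simp add: total_recursive_add assms)
qed

text \<open>The code of a nonempty list is the successor of a pair. With \<open>L\<close> of the
  form \<open>list_decode ...\<close> the rule also prepends to a list that is given by its
  code.\<close>

lemma total_recursive_list_encode_Cons:
  "total_recursive k F \<Longrightarrow> total_recursive k (\<lambda>xs. list_encode (L xs)) \<Longrightarrow>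
    total_recursive k (\<lambda>xs. list_encode (F xs # L xs))"
  by (simp add: total_recursive_Suc total_recursive_prod_encode)

lemmas total_recursive_intros =
  total_recursive_const total_recursive_list_encode_Cons total_recursive_proj total_recursive_Suc


section \<open>Closed CNF expressions\<close>

abbreviation Truth :: form where
  "Truth \<equiv> All 0 (Eq 0 0)"

abbreviation single :: "expr \<Rightarrow> builder" where
  "single e \<equiv> Builder e [] Truth"

lemma builder_vals_single: "builder_vals (single e) \<sigma> = {expr_val e \<sigma>}"
  by (auto simp: fun_eq_iff[symmetric])

definition pair_expr :: "expr \<Rightarrow> expr \<Rightarrow> expr" where
  "pair_expr d e = Builders [single d, single (Builders [single d, single e])]"

lemma expr_val_pair_expr [simp]: "expr_val (pair_expr d e) \<sigma> = pair (expr_val d \<sigma>) (expr_val e \<sigma>)"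
  by (simp add: pair_expr_def pair_def builder_vals_single insert_commute del: builder_vals.simps)

lemma expr_fv_pair_expr [simp]: "expr_fv (pair_expr d e) = expr_fv d \<union> expr_fv e"
  by (auto simp: pair_expr_def)

definition bit_expr :: "bool \<Rightarrow> expr" where
  "bit_expr b = (if b then Builders [single (Builders [])] else Builders [])"

lemma expr_val_bit_expr [simp]: "expr_val (bit_expr b) \<sigma> = bit01 b"
  by (simp add: bit_expr_def bit01_def builder_vals_single del: builder_vals.simps)

lemma expr_fv_bit_expr [simp]: "expr_fv (bit_expr b) = {}"
  by (simp add: bit_expr_def)

lemma bit01_inject [simp]: "bit01 b = bit01 c \<longleftrightarrow> b = c"
proof -
  have "mk_set {mk_set {}} \<noteq> (mk_set {} :: 'b hset)"
    by (metis countable_empty countable_insert elems_mk_set insert_not_empty)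
  then show ?thesis by (auto simp: bit01_def)
qed

text \<open>The Zermelo numerals, used as names of relation symbols.\<close>

fun tag :: "nat \<Rightarrow> 'a hset" where
  "tag 0 = mk_set {}"
| "tag (Suc n) = mk_set {tag n}"

fun tag_expr :: "nat \<Rightarrow> expr" where
  "tag_expr 0 = Builders []"
| "tag_expr (Suc n) = Builders [single (tag_expr n)]"

lemma expr_val_tag_expr [simp]: "expr_val (tag_expr n) \<sigma> = tag n"
  by (induction n) (simp_all add: builder_vals_single del: builder_vals.simps)

lemma expr_fv_tag_expr [simp]: "expr_fv (tag_expr n) = {}"
  by (induction n) simp_all

lemma tag_inject [simp]: "(tag m :: 'a hset) = tag n \<longleftrightarrow> m = n"
proof -
  have inj: "(tag (Suc i) :: 'a hset) = tag (Suc j) \<longleftrightarrow> (tag i :: 'a hset) = tag j" for i j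
    by (metis elems_mk_set countable_empty countable_insert singleton_inject tag.simps(2))
  have neq: "(tag (Suc i) :: 'a hset) \<noteq> tag 0" "(tag 0 :: 'a hset) \<noteq> tag (Suc i)" for i
    by (metis elems_mk_set countable_empty countable_insert insert_not_empty tag.simps)+
  show ?thesis
  proof (induction m arbitrary: n)
    case 0
    show ?case using neq by (cases n) (simp_all del: tag.simps)
  next
    case (Suc m)
    then show ?case using neq inj by (cases n) (simp_all del: tag.simps)
  qed
qed

text \<open>The propositional variable for the statement \<open>r(as)\<close>: the name of
  \<open>r\<close>, paired with the arguments as nested pairs that end in the empty set.\<close>

definition pvar :: "'r::countable \<Rightarrow> 'a list \<Rightarrow> 'a hset" where
  "pvar r as = pair (tag (to_nat r)) (foldr (\<lambda>a. pair (Atom a)) as (mk_set {}))"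

definition pvar_expr :: "'r::countable \<Rightarrow> nat list \<Rightarrow> expr" where
  "pvar_expr r xs = pair_expr (tag_expr (to_nat r)) (foldr (\<lambda>x. pair_expr (Var x)) xs (Builders []))"

lemma expr_val_pvar_expr [simp]: "expr_val (pvar_expr r xs) \<sigma> = pvar r (map \<sigma> xs)"
proof -
  have "expr_val (foldr (\<lambda>x. pair_expr (Var x)) xs (Builders [])) \<sigma> =
      foldr (\<lambda>a. pair (Atom a)) (map \<sigma> xs) (mk_set {})"
    by (induction xs) simp_all
  then show ?thesis by (simp add: pvar_def pvar_expr_def)
qed

lemma expr_fv_pvar_expr [simp]: "expr_fv (pvar_expr r xs) = set xs"
  by (induction xs) (auto simp: pvar_expr_def)

lemma pair_neq_empty: "pair x y \<noteq> mk_set {}"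
  unfolding pair_def by (metis countable_empty countable_insert elems_mk_set insert_not_empty)

lemma pvar_inject [simp]: "pvar r as = pvar s bs \<longleftrightarrow> r = s \<and> as = bs"
proof -
  \<comment> \<open>Lists of different lengths stay apart because the terminating empty set is not a
    pair.\<close>
  have "foldr (\<lambda>a. pair (Atom a)) as (mk_set {}) = foldr (\<lambda>a. pair (Atom a)) bs (mk_set {})
      \<longleftrightarrow> as = bs"
  proof (induction as arbitrary: bs)
    case Nil
    show ?case by (cases bs) (simp_all add: pair_neq_empty[symmetric])
  next
    case (Cons a as)
    then show ?case by (cases bs) (simp_all add: pair_inject pair_neq_empty)
  qed
  then show ?thesis by (simp add: pvar_def pair_inject)
qed

section \<open>Families of clauses and their expressions\<close>

text \<open>
  \<open>Lit ys b r xs\<close> is the disjunction, over all values of the variables \<open>ys\<close>, of the literals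
  \<open>r(xs)\<close> or \<open>\<not> r(xs)\<close> according to \<open>b\<close>. A list of such disjunctions stands for the family of
  clauses obtained by letting the remaining variables range over all atoms.
\<close>

datatype 'r lit = Lit "nat list" bool 'r "nat list"

type_synonym 'r clause = "'r lit list"

fun lit_vars :: "'r lit \<Rightarrow> nat list" where
  "lit_vars (Lit ys b r xs) = xs"

fun lit_holds :: "('r \<Rightarrow> 'a list \<Rightarrow> bool) \<Rightarrow> (nat \<Rightarrow> 'a) \<Rightarrow> 'r lit \<Rightarrow> bool" where
  "lit_holds M \<sigma> (Lit ys b r xs) \<longleftrightarrow>
    (\<exists>\<tau>. (\<forall>y. y \<notin> set ys \<longrightarrow> \<tau> y = \<sigma> y) \<and> M r (map \<tau> xs) = b)"

definition models :: "('r \<Rightarrow> 'a list \<Rightarrow> bool) \<Rightarrow> 'r clause list \<Rightarrow> bool" where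
  "models M Cs \<longleftrightarrow> (\<forall>C\<in>set Cs. \<forall>\<sigma>. \<exists>l\<in>set C. lit_holds M \<sigma> l)"

fun lit_builder :: "'r::countable lit \<Rightarrow> builder" where
  "lit_builder (Lit ys b r xs) = Builder (pair_expr (pvar_expr r xs) (bit_expr b)) ys Truth"

definition clause_expr :: "'r::countable clause \<Rightarrow> expr" where
  "clause_expr C = Builders (map lit_builder C)"

text \<open>Variables that a literal binds itself are bound here as well; the inner binding shadows
  the outer one, and the expression is closed.\<close>

definition clause_builder :: "'r::countable clause \<Rightarrow> builder" where
  "clause_builder C = Builder (clause_expr C) (concat (map lit_vars C)) Truth"

definition cnf_expr :: "'r::countable clause list \<Rightarrow> expr" where
  "cnf_expr Cs = Builders (map clause_builder Cs)"

fun lit_pvars_builder :: "'r::countable lit \<Rightarrow> builder" where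
  "lit_pvars_builder (Lit ys b r xs) = Builder (pvar_expr r xs) xs Truth"

text \<open>The set \<open>X\<close> of propositional variables, as a closed expression because an
  instance requires a definable \<open>X\<close>.\<close>

definition pvars_expr :: "'r::countable clause list \<Rightarrow> expr" where
  "pvars_expr Cs = Builders (map lit_pvars_builder (concat Cs))"

lemma builder_fv_lit_builder: "builder_fv (lit_builder l) \<subseteq> set (lit_vars l)"
  by (cases l) auto

lemma expr_fv_cnf_expr: "expr_fv (cnf_expr Cs) = {}"
  using builder_fv_lit_builder by (fastforce simp: cnf_expr_def clause_builder_def clause_expr_def)

lemma builder_fv_lit_pvars_builder: "builder_fv (lit_pvars_builder l) = {}"
  by (cases l) auto

lemma expr_fv_pvars_expr: "expr_fv (pvars_expr Cs) = {}"
  by (auto simp: pvars_expr_def builder_fv_lit_pvars_builder)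

lemma is_set_Builders: "is_set (expr_val (Builders bs) \<sigma>)"
  by (simp add: is_set_def mk_set_def)

text \<open>Builders range only over valuations that keep the given values off their bound
  variables, whereas \<open>models\<close> quantifies over all valuations; this bridges the
  gap.\<close>

lemma lit_holds_cong:
  assumes "\<And>x. x \<in> set (lit_vars l) \<Longrightarrow> \<sigma> x = \<sigma>' x" "lit_holds M \<sigma> l"
  shows "lit_holds M \<sigma>' l"
proof (cases l)
  case (Lit ys b r xs)
  then obtain \<tau> where \<tau>: "\<forall>y. y \<notin> set ys \<longrightarrow> \<tau> y = \<sigma> y" "M r (map \<tau> xs) = b"
    using assms(2) by auto
  define \<tau>' where "\<tau>' = (\<lambda>y. if y \<in> set ys then \<tau> y else \<sigma>' y)"
  have "map \<tau>' xs = map \<tau> xs" using \<tau>(1) assms(1) Lit by (simp add: \<tau>'_def)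
  moreover have "\<forall>y. y \<notin> set ys \<longrightarrow> \<tau>' y = \<sigma>' y" by (simp add: \<tau>'_def)
  ultimately show ?thesis using \<tau>(2) unfolding Lit lit_holds.simps by metis
qed

section \<open>Satisfying valuations and relational models\<close>

context
  fixes Cs :: "'r::countable clause list" and \<sigma>0 :: "nat \<Rightarrow> 'a"
  assumes countable_atoms: "countable (UNIV :: 'a set)"
begin

lemma pair_in_clause:
  fixes C :: "'r clause"
  shows "pair x (bit01 b) \<in> elems (expr_val (clause_expr C) (\<sigma> :: nat \<Rightarrow> 'a)) \<longleftrightarrow>
    (\<exists>ys r xs \<tau>. Lit ys b r xs \<in> set C \<and> (\<forall>y. y \<notin> set ys \<longrightarrow> \<tau> y = \<sigma> y) \<and> x = pvar r (map \<tau> xs))"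
proof -
  have "pair x (bit01 b) \<in> builder_vals (lit_builder l) \<sigma> \<longleftrightarrow> (\<exists>ys r xs \<tau>. l = Lit ys b r xs \<and>
      (\<forall>y. y \<notin> set ys \<longrightarrow> \<tau> y = \<sigma> y) \<and> x = pvar r (map \<tau> xs))" for l :: "'r lit"
    by (cases l) (auto simp: pair_inject)
  then show ?thesis
    unfolding clause_expr_def elems_expr_val[OF countable_atoms] by simp blast
qed

lemma elems_clause:
  fixes C :: "'r clause"
  shows "c \<in> elems (expr_val (clause_expr C) (\<sigma> :: nat \<Rightarrow> 'a)) \<Longrightarrow> \<exists>x b. c = pair x (bit01 b)"
  unfolding clause_expr_def elems_expr_val[OF countable_atoms]
proof clarsimp
  fix l :: "'r lit" assume "c \<in> builder_vals (lit_builder l) \<sigma>"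
  then show ?thesis by (cases l) auto
qed

lemma elems_cnf:
  "elems (expr_val (cnf_expr Cs) \<sigma>0) = {expr_val (clause_expr C) \<sigma> | C \<sigma>.
    C \<in> set Cs \<and> (\<forall>y. y \<notin> set (concat (map lit_vars C)) \<longrightarrow> \<sigma> y = \<sigma>0 y)}"
  unfolding cnf_expr_def elems_expr_val[OF countable_atoms] by (auto simp: clause_builder_def)

lemma pvar_in_pvars:
  assumes "C \<in> set Cs" "Lit ys b r xs \<in> set C"
  shows "pvar r (map \<tau> xs) \<in> elems (expr_val (pvars_expr Cs) \<sigma>0)"
proof -
  \<comment> \<open>The builder admits only valuations equal to \<open>\<sigma>0\<close> off
    \<open>xs\<close>, so \<open>\<tau>\<close> is cut down to \<open>xs\<close>.\<close>
  define \<tau>' where "\<tau>' = (\<lambda>y. if y \<in> set xs then \<tau> y else \<sigma>0 y)"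
  have "map \<tau> xs = map \<tau>' xs" by (simp add: \<tau>'_def)
  then have "pvar r (map \<tau> xs) \<in> builder_vals (lit_pvars_builder (Lit ys b r xs)) \<sigma>0"
    by (auto simp: \<tau>'_def intro!: exI[of _ \<tau>'])
  moreover have "lit_pvars_builder (Lit ys b r xs) \<in> set (map lit_pvars_builder (concat Cs))"
    unfolding set_map set_concat using assms by blast
  ultimately show ?thesis
    unfolding pvars_expr_def elems_expr_val[OF countable_atoms] by blast
qed

lemma cnf_over_pvars: "cnf_over (expr_val (pvars_expr Cs) \<sigma>0) (expr_val (cnf_expr Cs) \<sigma>0)"
proof -
  let ?lits = "{pair x (bit01 b) | x b. x \<in> elems (expr_val (pvars_expr Cs) \<sigma>0)}"
  have sub: "c \<in> ?lits"
    if "C \<in> set Cs" and c: "c \<in> elems (expr_val (clause_expr C) \<sigma>)" for C c and \<sigma> :: "nat \<Rightarrow> 'a"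
  proof -
    obtain x b where "c = pair x (bit01 b)" using elems_clause[OF c] by blast
    moreover from this c obtain ys r xs \<tau> where "Lit ys b r xs \<in> set C" "x = pvar r (map \<tau> xs)"
      using pair_in_clause[of x b C \<sigma>] by blast
    ultimately show ?thesis using pvar_in_pvars[OF that(1)] by blast
  qed
  have sets: "is_set (expr_val (cnf_expr Cs) \<sigma>0)" "is_set (expr_val (pvars_expr Cs) \<sigma>0)"
      "is_set (expr_val (clause_expr C) \<sigma>)" for C :: "'r clause" and \<sigma> :: "nat \<Rightarrow> 'a"
    by (simp_all only: cnf_expr_def clause_expr_def pvars_expr_def is_set_Builders)
  have "is_set c \<and> elems c \<subseteq> ?lits" if c: "c \<in> elems (expr_val (cnf_expr Cs) \<sigma>0)" for c
  proof -
    obtain C \<sigma> where C: "C \<in> set Cs" "c = expr_val (clause_expr C) \<sigma>"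
      using c unfolding elems_cnf by blast
    show ?thesis unfolding C(2) using sets(3) sub[OF C(1)] by (intro conjI subsetI)
  qed
  then show ?thesis unfolding cnf_over_def using sets(1,2) by blast
qed

text \<open>The model reads the valuation at \<open>pvar r as\<close>. The set \<open>X\<close> is
  arbitrary, since membership in \<open>CNFSat\<close> only yields some definable
  \<open>X\<close>.\<close>

lemma satisfiable_imp_model:
  assumes "satisfiable X (expr_val (cnf_expr Cs) \<sigma>0)"
  shows "\<exists>M :: 'r \<Rightarrow> 'a list \<Rightarrow> bool. models M Cs"
proof -
  obtain v where v: "\<And>C. C \<in> elems (expr_val (cnf_expr Cs) \<sigma>0) \<Longrightarrow> \<exists>x. pair x (bit01 (v x)) \<in> elems C"
    using assms unfolding satisfiable_def by blast
  have "\<exists>l\<in>set C. lit_holds (\<lambda>r as. v (pvar r as)) \<sigma> l" if C: "C \<in> set Cs" for C \<sigma>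
  proof -
    let ?xs = "set (concat (map lit_vars C))"
    define \<sigma>' where "\<sigma>' = (\<lambda>y. if y \<in> ?xs then \<sigma> y else \<sigma>0 y)"
    have "expr_val (clause_expr C) \<sigma>' \<in> elems (expr_val (cnf_expr Cs) \<sigma>0)"
      unfolding elems_cnf using C
      by (intro CollectI exI[of _ C] exI[of _ \<sigma>']) (simp add: \<sigma>'_def)
    from v[OF this] obtain x where "pair x (bit01 (v x)) \<in> elems (expr_val (clause_expr C) \<sigma>')" ..
    then obtain ys r xs \<tau> where l: "Lit ys (v x) r xs \<in> set C"
        "\<forall>y. y \<notin> set ys \<longrightarrow> \<tau> y = \<sigma>' y" "x = pvar r (map \<tau> xs)"
      using pair_in_clause by blast
    then have "lit_holds (\<lambda>r as. v (pvar r as)) \<sigma>' (Lit ys (v x) r xs)" by auto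
    then have "lit_holds (\<lambda>r as. v (pvar r as)) \<sigma> (Lit ys (v x) r xs)"
      by (rule lit_holds_cong[rotated]) (use l(1) in \<open>force simp: \<sigma>'_def\<close>)
    then show ?thesis using l(1) by blast
  qed
  then show ?thesis unfolding models_def by blast
qed

lemma model_imp_satisfiable:
  fixes M :: "'r \<Rightarrow> 'a list \<Rightarrow> bool"
  assumes "models M Cs"
  shows "satisfiable (expr_val (pvars_expr Cs) \<sigma>0) (expr_val (cnf_expr Cs) \<sigma>0)"
proof -
  \<comment> \<open>By \<open>pvar_inject\<close>, \<open>v\<close> agrees with \<open>M\<close> on
    every \<open>pvar r as\<close>; elsewhere it is false.\<close>
  define v where "v x \<longleftrightarrow> (\<exists>r as. x = pvar r as \<and> M r as)" for x
  have "\<exists>x\<in>elems (expr_val (pvars_expr Cs) \<sigma>0). pair x (bit01 (v x)) \<in> elems (expr_val (clause_expr C) \<sigma>)"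
    if C: "C \<in> set Cs" for C and \<sigma> :: "nat \<Rightarrow> 'a"
  proof -
    obtain l where l: "l \<in> set C" "lit_holds M \<sigma> l" using assms C unfolding models_def by blast
    obtain ys b r xs where Lit: "l = Lit ys b r xs" by (cases l)
    obtain \<tau> where \<tau>: "\<forall>y. y \<notin> set ys \<longrightarrow> \<tau> y = \<sigma> y" "M r (map \<tau> xs) = b"
      using l(2) unfolding Lit by auto
    have "v (pvar r (map \<tau> xs)) = b" using \<tau>(2) by (auto simp: v_def)
    then have "pair (pvar r (map \<tau> xs)) (bit01 (v (pvar r (map \<tau> xs)))) \<in> elems (expr_val (clause_expr C) \<sigma>)"
      unfolding pair_in_clause using l(1) Lit \<tau>(1) by blast
    then show ?thesis using pvar_in_pvars[OF C] l(1) unfolding Lit by blast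
  qed
  then show ?thesis unfolding satisfiable_def elems_cnf by blast
qed

end

lemma presentation_closed: "presentation (e, []) \<longleftrightarrow> expr_fv e = {}"
  by (auto simp: presentation_def)

lemma definable_pvars: "definable_set (pres_val (pvars_expr Cs, []))"
proof -
  have "presentation (pvars_expr Cs, [])" by (simp add: presentation_closed expr_fv_pvars_expr)
  moreover have "is_set (pres_val (pvars_expr Cs, []))"
    by (simp add: pres_val_def pvars_expr_def is_set_Builders del: expr_val.simps)
  ultimately show ?thesis unfolding definable_set_def by blast
qed

lemma cnf_instance:
  assumes "countable (UNIV :: 'a set)"
  shows "presentation ((cnf_expr Cs, []) :: 'a presentation)"
    and "definable_set (pres_val ((pvars_expr Cs, []) :: 'a presentation))"
    and "cnf_over (pres_val (pvars_expr Cs, [])) (pres_val ((cnf_expr Cs, []) :: 'a presentation))"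
  using cnf_over_pvars[OF assms] definable_pvars
  by (simp_all only: presentation_closed expr_fv_cnf_expr pres_val_def prod.case)

lemma cnf_in_CNF_instances:
  assumes "countable (UNIV :: 'a set)"
  shows "((cnf_expr Cs, []) :: 'a presentation) \<in> CNF_instances"
  unfolding CNF_instances_def using cnf_instance[OF assms, of Cs] by blast

text \<open>Together with \<open>cnf_in_CNF_instances\<close>, this is all that the undecidability
  argument uses about values of expressions; from here on only relations on atoms matter.\<close>

lemma cnf_in_CNFSat_iff:
  fixes Cs :: "'r::countable clause list"
  assumes "countable (UNIV :: 'a set)"
  shows "((cnf_expr Cs, []) :: 'a presentation) \<in> CNFSat \<longleftrightarrow>
    (\<exists>M :: 'r \<Rightarrow> 'a list \<Rightarrow> bool. models M Cs)"
proof
  assume "((cnf_expr Cs, []) :: 'a presentation) \<in> CNFSat"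
  then obtain X where "satisfiable X (pres_val ((cnf_expr Cs, []) :: 'a presentation))"
    unfolding CNFSat_def by blast
  then show "\<exists>M :: 'r \<Rightarrow> 'a list \<Rightarrow> bool. models M Cs"
    unfolding pres_val_def prod.case by (rule satisfiable_imp_model[OF assms])
next
  assume "\<exists>M :: 'r \<Rightarrow> 'a list \<Rightarrow> bool. models M Cs"
  then obtain M :: "'r \<Rightarrow> 'a list \<Rightarrow> bool" where "models M Cs" ..
  then have "satisfiable (pres_val (pvars_expr Cs, [])) (pres_val ((cnf_expr Cs, []) :: 'a presentation))"
    unfolding pres_val_def prod.case by (rule model_imp_satisfiable[OF assms])
  then show "((cnf_expr Cs, []) :: 'a presentation) \<in> CNFSat"
    unfolding CNFSat_def using cnf_instance[OF assms, of Cs] by blast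
qed


section \<open>Partial recursive functions as Horn theories\<close>

text \<open>
  Atoms stand for natural numbers and, via \<^const>\<open>list_encode\<close>, for argument lists. In particular
  zero is also the empty list. \<open>Val f\<close> is the graph of \<open>f\<close>, \<open>Vals gs\<close> that of a
  list of functions, and \<open>Pos f\<close> holds for \<open>n\<close> and \<open>l\<close> if \<open>f(m, l) > 0\<close> for all \<open>m < n\<close>.
\<close>

instance recf :: countable
  by countable_datatype

datatype sym = IsZero | IsSuc | IsCons | Val recf | Vals "recf list" | Pos recf | Goal

instance sym :: countable
  by countable_datatype

definition horn :: "(sym \<times> nat list) list \<Rightarrow> sym \<Rightarrow> nat list \<Rightarrow> sym clause" where
  "horn B r xs = Lit [] True r xs # map (\<lambda>(s, ys). Lit [] False s ys) B"

lemma horn_holds: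
  "(\<exists>l\<in>set (horn B r xs). lit_holds M \<sigma> l) \<longleftrightarrow>
    ((\<forall>(s, ys)\<in>set B. M s (map \<sigma> ys)) \<longrightarrow> M r (map \<sigma> xs))"
proof -
  have "(\<forall>y. \<tau> y = \<sigma> y) \<longleftrightarrow> \<tau> = \<sigma>" for \<tau> by auto
  then show ?thesis by (auto simp: horn_def split: prod.splits)
qed

text \<open>Projection \<open>Suc i\<close> is projection \<open>i\<close> on the tail, so the rules
  for all smaller indices are included.\<close>

fun proj_clauses :: "nat \<Rightarrow> sym clause list" where
  "proj_clauses 0 = [horn [(IsCons, [0, 1, 2])] (Val (Proj 0)) [2, 0]]"
| "proj_clauses (Suc i) =
    horn [(IsCons, [0, 1, 2]), (Val (Proj i), [1, 3])] (Val (Proj (Suc i))) [2, 3] # proj_clauses i"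

text \<open>Only the rules for \<open>Vals\<close>; those for the listed functions are added by
  \<open>val_clauses\<close>.\<close>

fun vals_clauses :: "recf list \<Rightarrow> sym clause list" where
  "vals_clauses [] = [horn [(IsZero, [1])] (Vals []) [0, 1]]"
| "vals_clauses (g # gs) =
    horn [(Val g, [0, 1]), (Vals gs, [0, 2]), (IsCons, [1, 2, 3])] (Vals (g # gs)) [0, 3] #
    vals_clauses gs"

text \<open>The rules mirror the introduction rules of \<open>computes\<close>, followed by the
  rules of the subprograms. The bounded quantifier of \<open>computes_Mu\<close> is not a Horn
  condition; \<open>Pos\<close> replaces it by a recursion on the bound.\<close>

fun val_clauses :: "recf \<Rightarrow> sym clause list" where
  "val_clauses Zero = [horn [(IsZero, [1])] (Val Zero) [0, 1]]"
| "val_clauses Succ =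
    [horn [(IsZero, [0]), (IsCons, [1, 0, 2]), (IsSuc, [1, 3])] (Val Succ) [2, 3]]"
| "val_clauses (Proj i) = proj_clauses i"
| "val_clauses (Comp f gs) =
    horn [(Vals gs, [0, 1]), (Val f, [1, 2])] (Val (Comp f gs)) [0, 2] #
    vals_clauses gs @ concat (map val_clauses gs) @ val_clauses f"
| "val_clauses (Prec f g) =
    horn [(IsZero, [0]), (IsCons, [0, 1, 2]), (Val f, [1, 3])] (Val (Prec f g)) [2, 3] #
    horn [(IsSuc, [0, 1]), (IsCons, [0, 2, 3]), (IsCons, [1, 2, 4]), (Val (Prec f g), [3, 5]),
        (IsCons, [5, 2, 6]), (IsCons, [0, 6, 7]), (Val g, [7, 8])] (Val (Prec f g)) [4, 8] #
    val_clauses f @ val_clauses g"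
| "val_clauses (Mu f) =
    horn [(IsZero, [0])] (Pos f) [0, 1] #
    horn [(Pos f, [0, 1]), (IsCons, [0, 1, 2]), (Val f, [2, 3]), (IsSuc, [4, 3]), (IsSuc, [0, 5])]
      (Pos f) [5, 1] #
    horn [(Pos f, [0, 1]), (IsCons, [0, 1, 2]), (Val f, [2, 3]), (IsZero, [3])] (Val (Mu f)) [1, 0] #
    val_clauses f"

text \<open>These assert existence only: a model may have several zeros or identify different
  numbers.\<close>

definition total_clauses :: "sym clause list" where
  "total_clauses =
    [[Lit [0] True IsZero [0]], [Lit [1] True IsSuc [0, 1]], [Lit [2] True IsCons [0, 1, 2]]]"

text \<open>
  The symbol \<^const>\<open>Goal\<close> does not mention \<open>e\<close>: the reduction must produce the clause denying
  it without knowing \<open>e\<close>.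
\<close>

definition theory_clauses :: "recf \<Rightarrow> sym clause list" where
  "theory_clauses e =
    horn [(IsZero, [0]), (IsSuc, [0, 1]), (IsCons, [2, 0, 3]), (Val e, [3, 1])] Goal [2] #
    total_clauses @ val_clauses e"

text \<open>Negates that the variables 0, ..., \<open>n\<close> hold the numbers 0, ...,
  \<open>n\<close>. A clause thus names a number in unary, without constants.\<close>

fun chain :: "nat \<Rightarrow> sym clause" where
  "chain 0 = [Lit [] False IsZero [0]]"
| "chain (Suc n) = Lit [] False IsSuc [n, Suc n] # chain n"

definition deny :: "nat \<Rightarrow> sym clause" where
  "deny n = Lit [] False Goal [n] # chain n"

lemma chain_holds:
  "(\<exists>l\<in>set (chain n). lit_holds M \<sigma> l) \<longleftrightarrow>
    \<not> (M IsZero [\<sigma> 0] \<and> (\<forall>i<n. M IsSuc [\<sigma> i, \<sigma> (Suc i)]))"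
proof -
  have "(\<forall>y. \<tau> y = \<sigma> y) \<longleftrightarrow> \<tau> = \<sigma>" for \<tau> by auto
  then show ?thesis by (induction n) (auto simp: less_Suc_eq)
qed

lemma deny_holds:
  "(\<exists>l\<in>set (deny n). lit_holds M \<sigma> l) \<longleftrightarrow>
    \<not> (M IsZero [\<sigma> 0] \<and> (\<forall>i<n. M IsSuc [\<sigma> i, \<sigma> (Suc i)]) \<and> M Goal [\<sigma> n])"
proof -
  have "(\<forall>y. \<tau> y = \<sigma> y) \<longleftrightarrow> \<tau> = \<sigma>" for \<tau> by auto
  then show ?thesis using chain_holds[of n M \<sigma>] by (auto simp: deny_def)
qed

subsection \<open>The standard model\<close>

fun standard :: "('a \<Rightarrow> nat) \<Rightarrow> recf \<Rightarrow> sym \<Rightarrow> 'a list \<Rightarrow> bool" where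
  "standard num e IsZero [a] \<longleftrightarrow> num a = 0"
| "standard num e IsSuc [a, b] \<longleftrightarrow> num b = Suc (num a)"
| "standard num e IsCons [a, b, c] \<longleftrightarrow> list_decode (num c) = num a # list_decode (num b)"
| "standard num e (Val f) [a, b] \<longleftrightarrow> computes f (list_decode (num a)) (num b)"
| "standard num e (Vals gs) [a, b] \<longleftrightarrow>
    list_all2 (\<lambda>g y. computes g (list_decode (num a)) y) gs (list_decode (num b))"
| "standard num e (Pos f) [a, b] \<longleftrightarrow>
    (\<forall>m<num a. \<exists>y. computes f (m # list_decode (num b)) (Suc y))"
| "standard num e Goal [a] \<longleftrightarrow> computes e [num a] 1"
| "standard num e _ _ \<longleftrightarrow> False"

lemma models_append: "models M (Cs @ Ds) \<longleftrightarrow> models M Cs \<and> models M Ds"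
  by (auto simp: models_def)

lemma models_Nil: "models M []"
  by (simp add: models_def)

lemma models_Cons: "models M (C # Cs) \<longleftrightarrow> (\<forall>\<sigma>. \<exists>l\<in>set C. lit_holds M \<sigma> l) \<and> models M Cs"
  by (auto simp: models_def)

lemma models_concat: "models M (concat Css) \<longleftrightarrow> (\<forall>Cs\<in>set Css. models M Cs)"
  by (auto simp: models_def)

lemmas models_simps = models_Nil models_Cons models_append models_concat horn_holds

lemma standard_proj: "models (standard num e) (proj_clauses i)"
proof (induction i)
  case 0
  show ?case using computes_Proj[of 0] by (fastforce simp: models_simps)
next
  case (Suc i)
  have "computes (Proj (Suc i)) (x # xs) y" if "computes (Proj i) xs y" for x xs y
    using that computes_Proj[of "Suc i" "x # xs"] by (auto elim: computes.cases)
  with Suc show ?case by (simp add: models_simps)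
qed

lemma standard_vals: "models (standard num e) (vals_clauses gs)"
  by (induction gs) (simp_all add: models_simps)

text \<open>Each Horn rule translates a closure property of \<open>computes\<close> or of the
  condition that \<open>Pos\<close> stands for.\<close>

lemma standard_val: "models (standard num e) (val_clauses f)"
proof (induction f)
  case (Prec f g)
  then show ?case by (auto simp: models_simps intro: computes_Prec_0 computes_Prec_Suc)
next
  case (Mu f)
  then show ?case by (auto simp: models_simps less_Suc_eq intro: computes_Mu)
qed (auto simp: models_simps standard_proj standard_vals
    intro: computes_Zero computes_Succ computes_Comp)

text \<open>Surjectivity supplies an atom for every number, hence for every list code; updating one
  variable with it satisfies the infinite clause.\<close>

lemma standard_total:
  fixes num :: "'a \<Rightarrow> nat"
  assumes "surj num"
  shows "models (standard num e) total_clauses"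
proof -
  obtain inv where inv: "\<And>n. num (inv n) = n"
    using assms by (metis surj_f_inv_f)
  have "\<exists>\<tau>. (\<forall>y. y \<noteq> 0 \<longrightarrow> \<tau> y = \<sigma> y) \<and> num (\<tau> 0) = 0" for \<sigma> :: "nat \<Rightarrow> 'a"
    by (intro exI[of _ "\<sigma>(0 := inv 0)"]) (simp add: inv)
  moreover have "\<exists>\<tau>. (\<forall>y. y \<noteq> 1 \<longrightarrow> \<tau> y = \<sigma> y) \<and> num (\<tau> 1) = Suc (num (\<tau> 0))"
    for \<sigma> :: "nat \<Rightarrow> 'a"
    by (intro exI[of _ "\<sigma>(1 := inv (Suc (num (\<sigma> 0))))"]) (simp add: inv)
  moreover have "\<exists>\<tau>. (\<forall>y. y \<noteq> 2 \<longrightarrow> \<tau> y = \<sigma> y) \<and>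
      list_decode (num (\<tau> 2)) = num (\<tau> 0) # list_decode (num (\<tau> 1))" for \<sigma> :: "nat \<Rightarrow> 'a"
    by (intro exI[of _ "\<sigma>(2 := inv (list_encode (num (\<sigma> 0) # list_decode (num (\<sigma> 1)))))"])
      (simp add: inv del: list_encode.simps)
  ultimately show ?thesis by (simp add: models_simps total_clauses_def)
qed

text \<open>In the standard model the chain can only fail to help if variable \<open>n\<close> holds
  the atom numbered \<open>n\<close>, and there \<open>Goal\<close> is false.\<close>

lemma standard_deny:
  assumes "\<not> computes e [n] 1"
  shows "\<exists>l\<in>set (deny n). lit_holds (standard num e) \<sigma> l"
proof -
  have "num (\<sigma> n) = n" if "num (\<sigma> 0) = 0" "\<forall>i<n. num (\<sigma> (Suc i)) = Suc (num (\<sigma> i))"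
    using that by (induction n) auto
  then show ?thesis using assms unfolding deny_holds by auto
qed

lemma standard_model:
  assumes "surj num" "\<not> computes e [n] 1"
  shows "models (standard num e) (deny n # theory_clauses e)"
proof -
  \<comment> \<open>Zero serves as the empty list at the end of \<open>[n]\<close> in the rule for
    \<open>Goal\<close>.\<close>
  have "list_decode 0 = []" by simp
  then show ?thesis
    using standard_deny[OF assms(2)] standard_total[OF assms(1)] standard_val
    by (auto simp: theory_clauses_def models_simps)
qed

subsection \<open>Arbitrary models\<close>

text \<open>Skolem functions for the totality clauses; iterating them names numbers and lists by
  atoms of an arbitrary model.\<close>

locale total_model =
  fixes M :: "sym \<Rightarrow> 'a list \<Rightarrow> bool" and z :: 'a and s :: "'a \<Rightarrow> 'a" and c :: "'a \<Rightarrow> 'a \<Rightarrow> 'a"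
  assumes M_zero: "M IsZero [z]" and M_suc: "M IsSuc [a, s a]" and M_cons: "M IsCons [a, b, c a b]"
begin

definition numeral_of :: "nat \<Rightarrow> 'a" where
  "numeral_of n = (s ^^ n) z"

definition list_of :: "nat list \<Rightarrow> 'a" where
  "list_of xs = foldr (\<lambda>x. c (numeral_of x)) xs z"

lemma numeral_of_simps [simp]: "numeral_of 0 = z" "numeral_of (Suc n) = s (numeral_of n)"
  by (simp_all add: numeral_of_def)

lemma list_of_simps [simp]: "list_of [] = z" "list_of (x # xs) = c (numeral_of x) (list_of xs)"
  by (simp_all add: list_of_def)

lemma model_proj:
  "models M (proj_clauses i) \<Longrightarrow> i < length xs \<Longrightarrow> M (Val (Proj i)) [list_of xs, numeral_of (xs ! i)]"
proof (induction i arbitrary: xs)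
  case 0
  then obtain x l where "xs = x # l" by (cases xs) auto
  moreover have "\<forall>\<sigma> :: nat \<Rightarrow> _. M IsCons [\<sigma> 0, \<sigma> 1, \<sigma> 2] \<longrightarrow> M (Val (Proj 0)) [\<sigma> 2, \<sigma> 0]"
    using 0(1) by (simp add: models_simps)
  \<comment> \<open>The valuation sends variable \<open>i\<close> to entry \<open>i\<close> of the
    list; the clause uses no later variable.\<close>
  note this[THEN spec, of "(!) [numeral_of x, list_of l, list_of xs]"]
  ultimately show ?case by (simp add: M_cons)
next
  case (Suc i)
  then obtain x l where xs: "xs = x # l" by (cases xs) auto
  with Suc have "M (Val (Proj i)) [list_of l, numeral_of (l ! i)]" by (simp add: models_simps)
  moreover have "\<forall>\<sigma> :: nat \<Rightarrow> _. M IsCons [\<sigma> 0, \<sigma> 1, \<sigma> 2] \<and> M (Val (Proj i)) [\<sigma> 1, \<sigma> 3]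
      \<longrightarrow> M (Val (Proj (Suc i))) [\<sigma> 2, \<sigma> 3]"
    using Suc(2) by (simp add: models_simps)
  note this[THEN spec, of "(!) [numeral_of x, list_of l, list_of xs, numeral_of (l ! i)]"]
  ultimately show ?case by (simp add: M_cons xs)
qed

lemma model_vals:
  "list_all2 (\<lambda>g y. M (Val g) [a, numeral_of y]) gs ys \<Longrightarrow> models M (vals_clauses gs) \<Longrightarrow>
    M (Vals gs) [a, list_of ys]"
proof (induction gs ys rule: list_all2_induct)
  case Nil
  have "\<forall>\<sigma> :: nat \<Rightarrow> _. M IsZero [\<sigma> 1] \<longrightarrow> M (Vals []) [\<sigma> 0, \<sigma> 1]"
    using Nil by (simp add: models_simps)
  from this[THEN spec, of "(!) [a, z]"] show ?case by (simp add: M_zero)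
next
  case (Cons g gs y ys)
  have "\<forall>\<sigma> :: nat \<Rightarrow> _. M (Val g) [\<sigma> 0, \<sigma> 1] \<and> M (Vals gs) [\<sigma> 0, \<sigma> 2] \<and> M IsCons [\<sigma> 1, \<sigma> 2, \<sigma> 3]
      \<longrightarrow> M (Vals (g # gs)) [\<sigma> 0, \<sigma> 3]"
    using Cons.prems by (simp add: models_simps)
  from this[THEN spec, of "(!) [a, numeral_of y, list_of ys, list_of (y # ys)]"] Cons
  show ?case by (simp add: M_cons models_simps)
qed

text \<open>By induction on the computation, every step fires the matching Horn rule, even in a
  nonstandard model.\<close>

lemma model_val:
  "computes f xs y \<Longrightarrow> models M (val_clauses f) \<Longrightarrow> M (Val f) [list_of xs, numeral_of y]"
proof (induction rule: computes.induct)
  case (computes_Zero xs)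
  then have "\<forall>\<sigma> :: nat \<Rightarrow> _. M IsZero [\<sigma> 1] \<longrightarrow> M (Val Zero) [\<sigma> 0, \<sigma> 1]"
    by (simp add: models_simps)
  from this[THEN spec, of "(!) [list_of xs, z]"] show ?case by (simp add: M_zero)
next
  case (computes_Succ x)
  then have "\<forall>\<sigma> :: nat \<Rightarrow> _. M IsZero [\<sigma> 0] \<and> M IsCons [\<sigma> 1, \<sigma> 0, \<sigma> 2] \<and> M IsSuc [\<sigma> 1, \<sigma> 3]
      \<longrightarrow> M (Val Succ) [\<sigma> 2, \<sigma> 3]"
    by (simp add: models_simps)
  from this[THEN spec, of "(!) [z, numeral_of x, list_of [x], numeral_of (Suc x)]"]
  show ?case by (simp add: M_zero M_suc M_cons)
next
  case (computes_Proj i xs)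
  then show ?case by (simp add: model_proj)
next
  case (computes_Comp xs gs ys f w)
  have "list_all2 (\<lambda>g y. M (Val g) [list_of xs, numeral_of y]) gs ys"
    using computes_Comp.IH(1) computes_Comp.prems
    by (auto simp: list_all2_conv_all_nth models_simps)
  then have "M (Vals gs) [list_of xs, list_of ys]"
    using computes_Comp.prems by (simp add: models_simps model_vals)
  moreover have "M (Val f) [list_of ys, numeral_of w]"
    using computes_Comp.IH(2) computes_Comp.prems by (simp add: models_simps)
  moreover have "\<forall>\<sigma> :: nat \<Rightarrow> _. M (Vals gs) [\<sigma> 0, \<sigma> 1] \<and> M (Val f) [\<sigma> 1, \<sigma> 2] \<longrightarrow> M (Val (Comp f gs)) [\<sigma> 0, \<sigma> 2]"
    using computes_Comp.prems by (simp add: models_simps)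
  note this[THEN spec, of "(!) [list_of xs, list_of ys, numeral_of w]"]
  ultimately show ?case by simp
next
  case (computes_Prec_0 f xs y g)
  then have "M (Val f) [list_of xs, numeral_of y]" by (simp add: models_simps)
  moreover have "\<forall>\<sigma> :: nat \<Rightarrow> _. M IsZero [\<sigma> 0] \<and> M IsCons [\<sigma> 0, \<sigma> 1, \<sigma> 2] \<and> M (Val f) [\<sigma> 1, \<sigma> 3]
      \<longrightarrow> M (Val (Prec f g)) [\<sigma> 2, \<sigma> 3]"
    using computes_Prec_0.prems by (simp add: models_simps)
  note this[THEN spec, of "(!) [z, list_of xs, list_of (0 # xs), numeral_of y]"]
  ultimately show ?case by (simp add: M_zero M_cons)
next
  case (computes_Prec_Suc f g n xs y w)
  have "M (Val (Prec f g)) [list_of (n # xs), numeral_of y]"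
      "M (Val g) [list_of (n # y # xs), numeral_of w]"
    using computes_Prec_Suc by (simp_all add: models_simps)
  moreover have "\<forall>\<sigma> :: nat \<Rightarrow> _. M IsSuc [\<sigma> 0, \<sigma> 1] \<and> M IsCons [\<sigma> 0, \<sigma> 2, \<sigma> 3] \<and>
      M IsCons [\<sigma> 1, \<sigma> 2, \<sigma> 4] \<and> M (Val (Prec f g)) [\<sigma> 3, \<sigma> 5] \<and> M IsCons [\<sigma> 5, \<sigma> 2, \<sigma> 6] \<and>
      M IsCons [\<sigma> 0, \<sigma> 6, \<sigma> 7] \<and> M (Val g) [\<sigma> 7, \<sigma> 8] \<longrightarrow> M (Val (Prec f g)) [\<sigma> 4, \<sigma> 8]"
    using computes_Prec_Suc.prems by (simp add: models_simps)
  note this[THEN spec, of "(!) [numeral_of n, numeral_of (Suc n), list_of xs, list_of (n # xs),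
    list_of (Suc n # xs), numeral_of y, list_of (y # xs), list_of (n # y # xs), numeral_of w]"]
  ultimately show ?case by (simp add: M_suc M_cons)
next
  case (computes_Mu f n xs)
  have Pos_0: "\<forall>\<sigma> :: nat \<Rightarrow> _. M IsZero [\<sigma> 0] \<longrightarrow> M (Pos f) [\<sigma> 0, \<sigma> 1]"
    and Pos_Suc: "\<forall>\<sigma> :: nat \<Rightarrow> _. M (Pos f) [\<sigma> 0, \<sigma> 1] \<and> M IsCons [\<sigma> 0, \<sigma> 1, \<sigma> 2] \<and> M (Val f) [\<sigma> 2, \<sigma> 3] \<and>
      M IsSuc [\<sigma> 4, \<sigma> 3] \<and> M IsSuc [\<sigma> 0, \<sigma> 5] \<longrightarrow> M (Pos f) [\<sigma> 5, \<sigma> 1]"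
    and Mu: "\<forall>\<sigma> :: nat \<Rightarrow> _. M (Pos f) [\<sigma> 0, \<sigma> 1] \<and> M IsCons [\<sigma> 0, \<sigma> 1, \<sigma> 2] \<and> M (Val f) [\<sigma> 2, \<sigma> 3] \<and>
      M IsZero [\<sigma> 3] \<longrightarrow> M (Val (Mu f)) [\<sigma> 1, \<sigma> 0]"
    and f: "models M (val_clauses f)"
    using computes_Mu.prems by (simp_all add: models_simps)
  \<comment> \<open>\<open>Pos\<close> climbs from 0 to \<open>n\<close>, using at each
    \<open>m\<close> that the value of \<open>f\<close> there is a successor.\<close>
  have "m \<le> n \<Longrightarrow> M (Pos f) [numeral_of m, list_of xs]" for m
  proof (induction m)
    case 0
    show ?case using Pos_0[THEN spec, of "(!) [z, list_of xs]"] by (simp add: M_zero)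
  next
    case (Suc m)
    obtain y where "M (Val f) [list_of (m # xs), numeral_of (Suc y)]"
      using computes_Mu.IH(2) f Suc.prems by (meson Suc_le_lessD)
    then show ?case
      using Suc Pos_Suc[THEN spec, of "(!) [numeral_of m, list_of xs, list_of (m # xs),
        numeral_of (Suc y), numeral_of y, numeral_of (Suc m)]"]
      by (simp add: M_suc M_cons)
  qed
  then have "M (Pos f) [numeral_of n, list_of xs]" by simp
  moreover have "M (Val f) [list_of (n # xs), z]" using computes_Mu.IH(1) f by simp
  ultimately show ?case
    using Mu[THEN spec, of "(!) [numeral_of n, list_of xs, list_of (n # xs), z]"]
    by (simp add: M_zero M_cons)
qed

end

lemma total_model_exists:
  assumes "models M total_clauses"
  shows "\<exists>z s c. total_model M z s c"
proof -
  have "\<exists>a. M IsZero [a]" "\<forall>a. \<exists>b. M IsSuc [a, b]" "\<forall>a b. \<exists>c. M IsCons [a, b, c]"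
  proof -
    have clauses:
      "\<forall>\<sigma> :: nat \<Rightarrow> _. \<exists>\<tau>. (\<forall>y. y \<noteq> 0 \<longrightarrow> \<tau> y = \<sigma> y) \<and> M IsZero [\<tau> 0]"
      "\<forall>\<sigma> :: nat \<Rightarrow> _. \<exists>\<tau>. (\<forall>y. y \<noteq> 1 \<longrightarrow> \<tau> y = \<sigma> y) \<and> M IsSuc [\<tau> 0, \<tau> 1]"
      "\<forall>\<sigma> :: nat \<Rightarrow> _. \<exists>\<tau>. (\<forall>y. y \<noteq> 2 \<longrightarrow> \<tau> y = \<sigma> y) \<and> M IsCons [\<tau> 0, \<tau> 1, \<tau> 2]"
      using assms by (simp_all add: total_clauses_def models_simps)
    show "\<exists>a. M IsZero [a]" using clauses(1) by blast
    show "\<forall>a. \<exists>b. M IsSuc [a, b]"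
    proof
      fix a show "\<exists>b. M IsSuc [a, b]" using clauses(2)[THEN spec, of "\<lambda>_. a"] by force
    qed
    show "\<forall>a b. \<exists>c. M IsCons [a, b, c]"
    proof (intro allI)
      fix a b show "\<exists>c. M IsCons [a, b, c]" using clauses(3)[THEN spec, of "\<lambda>i. [a, b] ! i"] by force
    qed
  qed
  then show ?thesis unfolding total_model_def by metis
qed

lemma no_model:
  assumes "computes e [n] 1"
  shows "\<not> models M (deny n # theory_clauses e)"
proof
  assume M: "models M (deny n # theory_clauses e)"
  then obtain z s c where "total_model M z s c"
    using total_model_exists[of M] by (auto simp: theory_clauses_def models_Cons models_append)
  then interpret total_model M z s c .
  have "M (Val e) [list_of [n], numeral_of 1]"
    using M by (intro model_val[OF assms]) (simp add: theory_clauses_def models_Cons models_append)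
  moreover have "\<forall>\<sigma> :: nat \<Rightarrow> _. M IsZero [\<sigma> 0] \<and> M IsSuc [\<sigma> 0, \<sigma> 1] \<and> M IsCons [\<sigma> 2, \<sigma> 0, \<sigma> 3] \<and>
      M (Val e) [\<sigma> 3, \<sigma> 1] \<longrightarrow> M Goal [\<sigma> 2]"
    using M by (simp add: theory_clauses_def models_simps)
  note this[THEN spec, of "(!) [z, s z, numeral_of n, list_of [n]]"]
  ultimately have "M Goal [numeral_of n]" by (simp add: M_zero M_suc M_cons)
  moreover have "\<forall>\<sigma> :: nat \<Rightarrow> _. \<not> (M IsZero [\<sigma> 0] \<and> (\<forall>i<n. M IsSuc [\<sigma> i, \<sigma> (Suc i)]) \<and> M Goal [\<sigma> n])"
    using M unfolding models_Cons deny_holds by blast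
  \<comment> \<open>Used as a valuation, \<open>numeral_of\<close> puts numeral \<open>i\<close>
    into variable \<open>i\<close>, which refutes every literal of the chain.\<close>
  note this[THEN spec, of numeral_of]
  ultimately show False by (simp add: M_zero M_suc)
qed


section \<open>The diagonal argument\<close>

lemma total_recursive_pair_expr:
  assumes "total_recursive k (\<lambda>xs. expr_code (D xs))" "total_recursive k (\<lambda>xs. expr_code (E xs))"
  shows "total_recursive k (\<lambda>xs. expr_code (pair_expr (D xs) (E xs)))"
  unfolding pair_expr_def expr_code.simps builder_code.simps list.map
  by (intro total_recursive_intros assms)

text \<open>The symbol and the number of arguments are fixed; only the variable names depend on the
  input.\<close>

lemma total_recursive_pvar_expr:
  assumes "\<And>F. F \<in> set Fs \<Longrightarrow> total_recursive k F"
  shows "total_recursive k (\<lambda>xs. expr_code (pvar_expr r (map (\<lambda>F. F xs) Fs)))"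
  unfolding pvar_expr_def
proof (rule total_recursive_pair_expr)
  show "total_recursive k (\<lambda>xs. expr_code
      (foldr (\<lambda>x. pair_expr (Var x)) (map (\<lambda>F. F xs) Fs) (Builders [])))"
    using assms
  proof (induction Fs)
    case (Cons F Fs)
    then have "total_recursive k (\<lambda>xs. expr_code (Var (F xs)))"
      unfolding expr_code.simps by (intro total_recursive_intros) simp
    with Cons show ?case by (simp add: total_recursive_pair_expr del: expr_code.simps)
  qed (simp add: total_recursive_const del: expr_code.simps)
qed (rule total_recursive_const)

lemma total_recursive_lit_builder:
  assumes "\<forall>F\<in>set Fs. total_recursive k F"
  shows "total_recursive k (\<lambda>xs. builder_code (lit_builder (Lit ys b r (map (\<lambda>F. F xs) Fs))))"
  unfolding lit_builder.simps builder_code.simps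
  by (intro total_recursive_intros total_recursive_pair_expr total_recursive_pvar_expr assms[rule_format])

text \<open>Passing from \<open>n\<close> to \<open>Suc n\<close> puts one literal in front, so the
  code is built by primitive recursion.\<close>

lemma total_recursive_chain_lits:
  "total_recursive 1 (\<lambda>xs. list_encode (map (\<lambda>l. builder_code (lit_builder l)) (chain (xs ! 0))))"
proof (rule total_recursive_primrec)
  let ?lit = "\<lambda>n. builder_code (lit_builder (Lit [] False IsSuc [n, Suc n]))"
  have "\<forall>F\<in>set [\<lambda>xs. xs ! 0, \<lambda>xs. Suc (xs ! 0)]. total_recursive 2 F"
    by (auto intro!: total_recursive_intros)
  from total_recursive_lit_builder[OF this] have "total_recursive 2 (\<lambda>xs. ?lit (xs ! 0))"
    unfolding list.map .
  \<comment> \<open>\<open>list_decode\<close> occurs only under \<open>list_encode\<close> and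
    cancels, so no decoder has to be programmed.\<close>
  moreover have "total_recursive 2 (\<lambda>xs. list_encode (list_decode (xs ! 1)))"
    by (simp add: total_recursive_proj)
  ultimately show "total_recursive 2 (\<lambda>xs. list_encode (?lit (xs ! 0) # list_decode (xs ! 1)))"
    by (rule total_recursive_list_encode_Cons)
qed (simp del: lit_builder.simps)

lemma total_recursive_chain_vars:
  "total_recursive 1 (\<lambda>xs. list_encode (concat (map lit_vars (chain (xs ! 0)))))"
proof (rule total_recursive_primrec)
  have "total_recursive 2 (\<lambda>xs. list_encode (list_decode (xs ! 1)))"
    by (simp add: total_recursive_proj)
  then show "total_recursive 2 (\<lambda>xs. list_encode (xs ! 0 # Suc (xs ! 0) # list_decode (xs ! 1)))"
    by (intro total_recursive_intros) simp_all
qed simp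

lemma total_recursive_deny: "total_recursive 1 (\<lambda>xs. builder_code (clause_builder (deny (xs ! 0))))"
proof -
  have lit: "total_recursive 1 (\<lambda>xs. builder_code (lit_builder (Lit [] False Goal [xs ! 0])))"
    using total_recursive_lit_builder[of "[\<lambda>xs. xs ! 0]" 1] unfolding list.map
    by (simp add: total_recursive_proj del: lit_builder.simps)
  have "total_recursive 1 (\<lambda>xs. list_encode (lit_vars (Lit [] False Goal [xs ! 0]) @
      concat (map lit_vars (chain (xs ! 0)))))"
    unfolding lit_vars.simps append.simps
    by (intro total_recursive_intros total_recursive_chain_vars) simp
  then show ?thesis
    unfolding clause_builder_def clause_expr_def deny_def builder_code.simps expr_code.simps
      list.map concat.simps map_map o_def
    by (intro total_recursive_intros lit total_recursive_chain_lits)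
qed

text \<open>The number \<open>h\<close> is used twice: as a code of clauses and as the argument in the denied goal.\<close>

definition reduction :: "nat \<Rightarrow> nat" where
  "reduction h =
    prod_encode (list_encode (1 # builder_code (clause_builder (deny h)) # list_decode h), 0)"

lemma total_recursive_reduction: "total_recursive 1 (\<lambda>xs. reduction (xs ! 0))"
proof -
  have "total_recursive 1 (\<lambda>xs. list_encode (list_decode (xs ! 0)))"
    by (simp add: total_recursive_proj)
  then show ?thesis
    unfolding reduction_def
    by (intro total_recursive_prod_encode total_recursive_intros total_recursive_deny)
qed

text \<open>As \<open>h\<close> is the code of the list of clause builders, prepending one more
  gives the extended formula. In \<open>reduction\<close>, 1 is the tag of \<open>Builders\<close>
  and 0 the code of the empty valuation.\<close>

lemma pres_code_diagonal:
  assumes "h = list_encode (map (\<lambda>C. builder_code (clause_builder C)) Cs)"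
  shows "pres_code num (cnf_expr (deny h # Cs), []) = reduction h"
proof -
  have "list_decode h = map (\<lambda>C. builder_code (clause_builder C)) Cs" using assms by simp
  then show ?thesis by (simp add: pres_code_def reduction_def cnf_expr_def comp_def)
qed

theorem theorem3p11:
  fixes num :: "'a \<Rightarrow> nat"
  assumes "bij num"
  shows "\<not> decidable (pres_code num) CNF_instances CNFSat"
proof
  assume "decidable (pres_code num) CNF_instances CNFSat"
  then obtain p where p: "\<And>P. P \<in> CNF_instances \<Longrightarrow>
      computes p [pres_code num P] (if P \<in> CNFSat then 1 else 0)"
    unfolding decidable_def by blast
  obtain q where "\<And>xs. length xs = 1 \<Longrightarrow> computes q xs (reduction (xs ! 0))"
    using total_recursive_reduction unfolding total_recursive_def by blast
  from this[of "[h]" for h] have q: "computes q [h] (reduction h)" for h by simp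
  define e where "e = Comp p [q]"
  \<comment> \<open>There is no circularity: \<open>theory_clauses e\<close> does not mention
    \<open>h\<close>, which enters only through the denying clause.\<close>
  define h where "h = list_encode (map (\<lambda>C. builder_code (clause_builder C)) (theory_clauses e))"
  define P :: "'a presentation" where "P = (cnf_expr (deny h # theory_clauses e), [])"
  have countable: "countable (UNIV :: 'a set)"
    using assms by (auto simp: countable_def bij_def)
  have "computes p [reduction h] (if P \<in> CNFSat then 1 else 0)"
    using p[OF cnf_in_CNF_instances[OF countable], of "deny h # theory_clauses e"]
    by (simp add: P_def pres_code_diagonal[OF h_def])
  then have e: "computes e [h] (if P \<in> CNFSat then 1 else 0)"
    unfolding e_def by (intro computes_Comp[where ys = "[reduction h]"]) (simp_all add: q)
  have "P \<in> CNFSat \<longleftrightarrow> (\<exists>M :: sym \<Rightarrow> 'a list \<Rightarrow> bool. models M (deny h # theory_clauses e))"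
    unfolding P_def by (rule cnf_in_CNFSat_iff[OF countable])
  also have "\<dots> \<longleftrightarrow> \<not> computes e [h] 1"
    using standard_model[OF bij_is_surj[OF assms]] no_model by metis
  \<comment> \<open>If \<open>P\<close> is in \<open>CNFSat\<close>, then \<open>e\<close> returns 1
    on \<open>h\<close> and does not; otherwise it returns both 0 and 1.\<close>
  finally show False using computes_deterministic[OF e, of 1] e by (auto split: if_splits)
qed

end
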